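(* Let $G\subset\mathbb{R}^n$ be a neighborhood of the origin and let $\frac{d\mathbf{x}}{dt}=\mathbf{f}(\mathbf{x})$ be an autonomous system of ordinary differential equations given in $G$, for which the origin $\mathbf{0}$ is an isolated equilibrium. Suppose that in $G$ there is a convergent sequence of hypersurfaces $\mathbf{H}_i^{n-1}$ ($i=1,2,\dots$), with associated compact sets $\mathbf{K}_i$, and for each $i$ let $\vec N$ be the unit normal vector field on $\mathbf{H}_i^{n-1}$ directed to the inside of $\mathbf{K}_i$. If for every $i$ and every $\mathbf{x}\in\mathbf{H}_i^{n-1}$ one has $S(\mathbf{x})=\langle \vec N(\mathbf{x}),\mathbf{f}(\mathbf{x})\rangle>0$, and if $\{\mathbf{0}\}$ is the only nonempty invariant set of the system in $G$, then the equilibrium $\mathbf{0}$ of the system is asymptotically stable in the sense of Lyapunov.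
   Context: A compact connected smooth $(n-1)$-dimensional submanifold $\mathbf{H}^{n-1}$ of $\mathbb{R}^n$ lying in $G$ is said to restrict the origin if $\mathbf{0}\notin\mathbf{H}^{n-1}$ and $\mathbf{H}^{n-1}$ is the boundary of a compact set $\mathbf{K}$ containing the origin. A sequence $\mathbf{H}_i^{n-1}$ ($i=1,2,\dots$) of hypersurfaces restricting the origin is a convergent sequence of hypersurfaces if the $\mathbf{H}_i^{n-1}$ are pairwise disjoint and there are compact sets $\mathbf{K}_i$ containing the origin with boundary $\mathbf{H}_i^{n-1}$ such that $\bigcap_i\mathbf{K}_i=\{\mathbf{0}\}$ and $\mathbf{K}_i\supset\mathbf{K}_j$ for $i<j$. Here $\langle\cdot,\cdot\rangle$ is the Euclidean inner product. The map $\mathbf{f}:G\to\mathbb{R}^n$ is continuous and through every point of $G$ there passes a unique phase curve (solution) of the system. An equilibrium is a zero of $\mathbf{f}$; it is isolated if it has a neighborhood containing no other zero of $\mathbf{f}$. A set $M\subset G$ is invariant if every phase curve starting at a point of $M$ is defined for all $t\in\mathbb{R}$ and stays in $M$ for all $t\in\mathbb{R}$. *)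

theory Defs
  imports "HOL-Analysis.Analysis"
begin

(* Intended for open S: all derivatives are Frechet derivatives at interior points. *)
primrec Ck_on :: "nat \<Rightarrow> 'a::real_normed_vector set \<Rightarrow> ('a \<Rightarrow> 'b::real_normed_vector) \<Rightarrow> bool" where
  "Ck_on 0 S f \<longleftrightarrow> continuous_on S f"
| "Ck_on (Suc k) S f \<longleftrightarrow>
     (\<forall>x\<in>S. f differentiable (at x)) \<and> (\<forall>v. Ck_on k S (\<lambda>x. frechet_derivative f (at x) v))"

definition smooth_on :: "'a::real_normed_vector set \<Rightarrow> ('a \<Rightarrow> 'b::real_normed_vector) \<Rightarrow> bool" where
  "smooth_on S f \<longleftrightarrow> (\<forall>k. Ck_on k S f)"

(* Embedded d-dimensional submanifold without boundary: near each of its points, a smooth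
   diffeomorphism between open sets of the ambient space flattens H onto a d-dimensional
   linear subspace. *)
definition smooth_submanifold :: "nat \<Rightarrow> 'a::euclidean_space set \<Rightarrow> bool" where
  "smooth_submanifold d H \<longleftrightarrow>
     (\<forall>p\<in>H. \<exists>U V \<phi> \<psi> L. open U \<and> p \<in> U \<and> open (V :: 'a set) \<and>
        homeomorphism U V \<phi> \<psi> \<and> smooth_on U \<phi> \<and> smooth_on V \<psi> \<and>
        subspace L \<and> dim L = d \<and> \<phi> ` (U \<inter> H) = V \<inter> L)"

(* Velocities at p of curves lying in H. *)
definition tangent_space :: "'a::euclidean_space set \<Rightarrow> 'a \<Rightarrow> 'a set" where
  "tangent_space H p =
     {v. \<exists>\<gamma> e. 0 < e \<and> \<gamma> ` {-e<..<e} \<subseteq> H \<and> \<gamma> 0 = p \<and>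
        (\<gamma> has_vector_derivative v) (at (0::real))}"

(* The last conjunct says that N p is directed to the inside of K. *)
definition inward_unit_normal_field ::
    "'a::euclidean_space set \<Rightarrow> 'a set \<Rightarrow> ('a \<Rightarrow> 'a) \<Rightarrow> bool" where
  "inward_unit_normal_field H K N \<longleftrightarrow>
     (\<forall>p\<in>H. norm (N p) = 1 \<and> (\<forall>v\<in>tangent_space H p. N p \<bullet> v = 0) \<and>
        (\<exists>e>0. \<forall>t. 0 < t \<and> t < e \<longrightarrow> p + t *\<^sub>R N p \<in> interior K))"

definition restricts_origin :: "'a::euclidean_space set \<Rightarrow> 'a set \<Rightarrow> bool" where
  "restricts_origin G H \<longleftrightarrow>
     compact H \<and> connected H \<and> smooth_submanifold (DIM('a) - 1) H \<and> H \<subseteq> G \<and>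
     0 \<notin> H \<and> (\<exists>K. compact K \<and> 0 \<in> K \<and> frontier K = H)"

(* K records the compact sets associated with the hypersurfaces; both sequences are indexed
   from 0. *)
definition convergent_hypersurfaces ::
    "'a::euclidean_space set \<Rightarrow> (nat \<Rightarrow> 'a set) \<Rightarrow> (nat \<Rightarrow> 'a set) \<Rightarrow> bool" where
  "convergent_hypersurfaces G H K \<longleftrightarrow>
     (\<forall>i. restricts_origin G (H i)) \<and> disjoint_family H \<and>
     (\<forall>i. compact (K i) \<and> 0 \<in> K i \<and> frontier (K i) = H i) \<and>
     (\<Inter>i. K i) = {0} \<and> (\<forall>i j. i < j \<longrightarrow> K j \<subseteq> K i)"

definition solution_on ::
    "('a::euclidean_space \<Rightarrow> 'a) \<Rightarrow> 'a set \<Rightarrow> real set \<Rightarrow> (real \<Rightarrow> 'a) \<Rightarrow> bool" where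
  "solution_on f G J x \<longleftrightarrow> open J \<and> is_interval J \<and>
     (\<forall>t\<in>J. x t \<in> G \<and> (x has_vector_derivative f (x t)) (at t))"

(* A phase curve is a maximal (non-extendable) solution, here starting at p at time 0; the
   values of x outside J are irrelevant. *)
definition phase_curve ::
    "('a::euclidean_space \<Rightarrow> 'a) \<Rightarrow> 'a set \<Rightarrow> 'a \<Rightarrow> real set \<Rightarrow> (real \<Rightarrow> 'a) \<Rightarrow> bool" where
  "phase_curve f G p J x \<longleftrightarrow> solution_on f G J x \<and> 0 \<in> J \<and> x 0 = p \<and>
     (\<forall>J' y. solution_on f G J' y \<and> J \<subseteq> J' \<and> (\<forall>t\<in>J. y t = x t) \<longrightarrow> J' = J)"

definition unique_phase_curves :: "('a::euclidean_space \<Rightarrow> 'a) \<Rightarrow> 'a set \<Rightarrow> bool" where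
  "unique_phase_curves f G \<longleftrightarrow>
     (\<forall>p\<in>G. \<exists>J x. phase_curve f G p J x \<and>
        (\<forall>J' y. phase_curve f G p J' y \<longrightarrow> J' = J \<and> (\<forall>t\<in>J. y t = x t)))"

definition invariant_set :: "('a::euclidean_space \<Rightarrow> 'a) \<Rightarrow> 'a set \<Rightarrow> 'a set \<Rightarrow> bool" where
  "invariant_set f G M \<longleftrightarrow> M \<subseteq> G \<and>
     (\<forall>p\<in>M. \<forall>J x. phase_curve f G p J x \<longrightarrow> J = UNIV \<and> (\<forall>t. x t \<in> M))"

definition equilibrium :: "('a::euclidean_space \<Rightarrow> 'a) \<Rightarrow> 'a set \<Rightarrow> 'a \<Rightarrow> bool" where
  "equilibrium f G q \<longleftrightarrow> q \<in> G \<and> f q = 0"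

definition isolated_equilibrium :: "('a::euclidean_space \<Rightarrow> 'a) \<Rightarrow> 'a set \<Rightarrow> 'a \<Rightarrow> bool" where
  "isolated_equilibrium f G q \<longleftrightarrow> equilibrium f G q \<and>
     (\<exists>U. open U \<and> q \<in> U \<and> (\<forall>y\<in>U. equilibrium f G y \<longrightarrow> y = q))"

definition lyapunov_stable :: "('a::euclidean_space \<Rightarrow> 'a) \<Rightarrow> 'a set \<Rightarrow> 'a \<Rightarrow> bool" where
  "lyapunov_stable f G q \<longleftrightarrow>
     (\<forall>\<epsilon>>0. \<exists>\<delta>>0. \<forall>p\<in>G. dist p q < \<delta> \<longrightarrow>
        (\<forall>J x. phase_curve f G p J x \<longrightarrow> {0..} \<subseteq> J \<and> (\<forall>t\<ge>0. dist (x t) q < \<epsilon>)))"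

definition asymptotically_stable :: "('a::euclidean_space \<Rightarrow> 'a) \<Rightarrow> 'a set \<Rightarrow> 'a \<Rightarrow> bool" where
  "asymptotically_stable f G q \<longleftrightarrow> lyapunov_stable f G q \<and>
     (\<exists>\<delta>>0. \<forall>p\<in>G. dist p q < \<delta> \<longrightarrow>
        (\<forall>J x. phase_curve f G p J x \<longrightarrow> {0..} \<subseteq> J \<and> (x \<longlongrightarrow> q) at_top))"

end

theory Submission
  imports Defs "HOL-Complex_Analysis.Great_Picard"
begin

text \<open>
  The hypersurfaces act as one-way membranes. At a point of the boundary of \<open>K i\<close> the velocity
  makes a positive angle with the inward normal, so a solution that touches the boundary is inside
  immediately afterwards (\<open>enters_across_hypersurface\<close>) and no solution can leave \<open>K i\<close> in forward
  time (\<open>positively_invariant_inside_hypersurface\<close>). Being trapped in a compact subset of \<open>G\<close>, such a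
  solution cannot end in finite time: its velocity is bounded, so it would have a limit point in \<open>G\<close>
  from which it could be continued (\<open>confined_phase_curve_is_global\<close>). The sets \<open>K i\<close> are
  neighbourhoods of the origin that shrink to it, hence they form a basis of trapping neighbourhoods,
  and this is Lyapunov stability.

  Attraction needs only one of the trapping sets inside \<open>G\<close>. A solution that stays in a compact set
  has a nonempty omega-limit set, and this set is invariant (\<open>omega_limit_invariant\<close>): time shifts of
  the solution are equi-Lipschitz, so a subsequence converges pointwise on the whole real line to a
  curve which is again a solution, passes through the given limit point, and consists of limit points.
  Uniqueness of phase curves identifies this curve with the phase curve of the limit point. As
  \<open>{0}\<close> is the only nonempty invariant set, the origin is the only limit point, and a curve in a
  compact set with a single limit point converges to it.
\<close>

section \<open>Estimates along curves with controlled velocity\<close>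

text \<open>
  This form of the mean value inequality replaces integral equations throughout: a curve solves the
  system at a point as soon as it has such linear approximations with \<open>v\<close> the value of the field there and
  arbitrarily small \<open>e\<close>. The inequality survives pointwise limits of curves and needs no derivative at
  the end points, which are exactly the two situations in which new solutions are built below.
\<close>

lemma linear_approximation_bound:
  fixes x :: "real \<Rightarrow> 'a::real_normed_vector"
  assumes "s \<le> t" and "continuous_on {s..t} x"
    and "\<And>r. s < r \<Longrightarrow> r < t \<Longrightarrow> (x has_vector_derivative x' r) (at r)"
    and "\<And>r. s < r \<Longrightarrow> r < t \<Longrightarrow> norm (x' r - v) \<le> e"
  shows "norm (x t - x s - (t - s) *\<^sub>R v) \<le> e * (t - s)"
proof (cases "s = t")
  case True
  then show ?thesis by simp
next
  case False
  with assms(1) have "s < t" by simp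
  have "norm ((\<lambda>r. x r - r *\<^sub>R v) t - (\<lambda>r. x r - r *\<^sub>R v) s) \<le> (\<lambda>r. e * r) t - (\<lambda>r. e * r) s"
  proof (rule differentiable_bound_general[OF \<open>s < t\<close>, where f' = "\<lambda>r. x' r - v" and \<phi>' = "\<lambda>r. e"])
    show "continuous_on {s..t} (\<lambda>r. x r - r *\<^sub>R v)"
      by (intro continuous_intros assms)
    show "continuous_on {s..t} (\<lambda>r. e * r)"
      by (intro continuous_intros)
    fix r assume r: "s < r" "r < t"
    show "((\<lambda>r. x r - r *\<^sub>R v) has_vector_derivative x' r - v) (at r)"
      by (auto intro!: derivative_eq_intros assms r)
    show "((\<lambda>r. e * r) has_vector_derivative e) (at r)"
      by (auto intro!: derivative_eq_intros)
    show "norm (x' r - v) \<le> e"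
      by (rule assms(4)[OF r])
  qed
  then show ?thesis
    by (simp add: algebra_simps)
qed

lemma solution_on_continuous:
  assumes "solution_on f G J x"
  shows "continuous_on J x"
  using assms unfolding solution_on_def
  by (meson continuous_at_imp_continuous_on has_vector_derivative_continuous)

lemma solution_on_lipschitz:
  assumes "solution_on f G J x" and "{s..t} \<subseteq> J" and "s \<le> t"
    and "\<And>r. r \<in> {s..t} \<Longrightarrow> norm (f (x r)) \<le> L"
  shows "norm (x t - x s) \<le> L * (t - s)"
proof -
  have "norm (x t - x s - (t - s) *\<^sub>R 0) \<le> L * (t - s)"
  proof (rule linear_approximation_bound[where x' = "\<lambda>r. f (x r)"])
    show "continuous_on {s..t} x"
      using solution_on_continuous[OF assms(1)] assms(2) continuous_on_subset by blast
    show "(x has_vector_derivative f (x r)) (at r)" if "s < r" "r < t" for r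
      using assms(1) subsetD[OF assms(2), of r] that by (simp add: solution_on_def)
  qed (use assms in auto)
  then show ?thesis by simp
qed

section \<open>Crossing a hypersurface\<close>

lemma crosses_hyperplane:
  fixes g :: "real \<Rightarrow> 'a::euclidean_space"
  assumes g: "(g has_vector_derivative w) (at s)"
    and "n \<bullet> g s = 0" and "n \<bullet> w > 0"
  shows "\<forall>\<^sub>F t in at_right s. n \<bullet> g t > 0"
proof -
  have "((\<lambda>t. n \<bullet> g t) has_vector_derivative n \<bullet> w) (at s)"
    using bounded_linear.has_vector_derivative[OF bounded_linear_inner_right g] .
  then have "((\<lambda>t. n \<bullet> g t) has_real_derivative n \<bullet> w) (at s)"
    by (simp add: has_real_derivative_iff_has_vector_derivative)
  from has_real_derivative_pos_inc_right[OF this assms(3)] assms(2)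
  obtain d where d: "d > 0" "\<And>h. 0 < h \<Longrightarrow> h < d \<Longrightarrow> 0 < n \<bullet> g (s + h)"
    by auto
  show ?thesis
    unfolding eventually_at_right_field
  proof (intro exI[of _ "s + d"] conjI allI impI)
    fix t assume "s < t" "t < s + d"
    then show "0 < n \<bullet> g t" using d(2)[of "t - s"] by simp
  qed (use d in auto)
qed

lemma smooth_on_differentiable:
  assumes "smooth_on S f" and "x \<in> S"
  shows "(f has_derivative frechet_derivative f (at x)) (at x)"
proof -
  have "Ck_on (Suc 0) S f" using assms(1) unfolding smooth_on_def by blast
  then show ?thesis using assms(2) frechet_derivative_works by auto
qed

text \<open>
  In the flattening chart the hypersurface becomes a hyperplane with some normal \<open>n\<close>. The derivative of
  the chart carries tangent vectors into the hyperplane, so it carries the half-space of vectors having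
  positive inner product with the inward normal \<open>m\<close> to a half-space bounded by the hyperplane; with the
  sign of \<open>n\<close> chosen by \<open>m\<close>, the velocity \<open>v\<close> points to the side \<open>n > 0\<close>. The preimage of a half-ball
  on that side is connected and misses the frontier of \<open>K\<close>, so it lies in \<open>K\<close> as soon as it meets \<open>K\<close>,
  and it does meet \<open>K\<close> along the normal line.
\<close>

lemma enters_across_hypersurface:
  fixes K :: "'a::euclidean_space set"
  assumes sm: "smooth_submanifold (DIM('a) - 1) (frontier K)"
    and nf: "inward_unit_normal_field (frontier K) K N"
    and xs: "x s \<in> frontier K" and xd: "(x has_vector_derivative v) (at s)"
    and pos: "N (x s) \<bullet> v > 0"
  shows "\<forall>\<^sub>F t in at_right s. x t \<in> K"
proof -
  define p where "p = x s"
  define m where "m = N p"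
  have p: "p \<in> frontier K" using xs p_def by simp
  obtain U V \<phi> \<psi> L where U: "open U" "p \<in> U" and V: "open (V :: 'a set)"
    and hom: "homeomorphism U V \<phi> \<psi>" and sm\<phi>: "smooth_on U \<phi>" and sm\<psi>: "smooth_on V \<psi>"
    and L: "subspace L" "dim L = DIM('a) - 1" and flat: "\<phi> ` (U \<inter> frontier K) = V \<inter> L"
    using sm p unfolding smooth_submanifold_def by metis
  define A where "A = frechet_derivative \<phi> (at p)"
  define B where "B = frechet_derivative \<psi> (at (\<phi> p))"
  have \<psi>\<phi>: "\<psi> (\<phi> u) = u" if "u \<in> U" for u using hom that by (simp add: homeomorphism_def)
  have \<phi>\<psi>: "\<phi> (\<psi> z) = z" if "z \<in> V" for z using hom that by (simp add: homeomorphism_def)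
  have imU: "\<psi> z \<in> U" if "z \<in> V" for z using hom that by (auto simp: homeomorphism_def)
  have q: "\<phi> p \<in> V" "\<phi> p \<in> L" using flat p U by auto
  have dA: "(\<phi> has_derivative A) (at p)"
    unfolding A_def by (rule smooth_on_differentiable[OF sm\<phi> U(2)])
  have dB: "(\<psi> has_derivative B) (at (\<phi> p))"
    unfolding B_def by (rule smooth_on_differentiable[OF sm\<psi> q(1)])
  have linA: "linear A" and linB: "linear B" using dA dB has_derivative_linear by auto
  have BA: "B (A u) = u" for u
  proof -
    have "(\<psi> \<circ> \<phi> has_derivative B \<circ> A) (at p)" by (rule diff_chain_at[OF dA dB])
    moreover have "(\<psi> \<circ> \<phi> has_derivative id) (at p)"
      by (rule has_derivative_transform_within_open[OF has_derivative_id U]) (simp add: \<psi>\<phi>)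
    ultimately have "B \<circ> A = id" by (rule has_derivative_unique)
    then show ?thesis by (metis comp_apply id_apply)
  qed
  have unit: "m \<bullet> m = 1" and tang: "\<And>u. u \<in> tangent_space (frontier K) p \<Longrightarrow> m \<bullet> u = 0"
    using nf p unfolding inward_unit_normal_field_def m_def by (auto simp: norm_eq_1)
  have L_tangent: "m \<bullet> B l = 0" if l: "l \<in> L" for l
  proof (rule tang)
    have "\<forall>\<^sub>F t in at (0::real). \<phi> p + t *\<^sub>R l \<in> V"
    proof (rule topological_tendstoD[OF _ V])
      show "((\<lambda>t. \<phi> p + t *\<^sub>R l) \<longlongrightarrow> \<phi> p) (at 0)"
        by (auto intro!: tendsto_eq_intros)
    qed (rule q)
    then obtain e where e: "e > 0" "\<And>t. t \<noteq> 0 \<Longrightarrow> dist t 0 < e \<Longrightarrow> \<phi> p + t *\<^sub>R l \<in> V"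
      unfolding eventually_at by auto
    have inV: "\<phi> p + t *\<^sub>R l \<in> V \<inter> L" if "t \<in> {-e<..<e}" for t
      using that e q l L(1) by (cases "t = 0") (auto simp: subspace_add subspace_scale dist_real_def)
    define \<gamma> where "\<gamma> = \<psi> \<circ> (\<lambda>t::real. \<phi> p + t *\<^sub>R l)"
    have "\<gamma> ` {-e<..<e} \<subseteq> frontier K"
    proof clarify
      fix t assume "t \<in> {-e<..<e}"
      then have "\<phi> p + t *\<^sub>R l \<in> \<phi> ` (U \<inter> frontier K)" using inV flat by simp
      then show "\<gamma> t \<in> frontier K" by (auto simp: \<gamma>_def \<psi>\<phi>)
    qed
    moreover have "\<gamma> 0 = p" by (simp add: \<gamma>_def \<psi>\<phi> U)
    moreover have "(\<gamma> has_vector_derivative B l) (at 0)"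
    proof -
      have "((\<lambda>t::real. \<phi> p + t *\<^sub>R l) has_vector_derivative l) (at 0)"
        by (auto intro!: derivative_eq_intros)
      from vector_derivative_diff_chain_within[OF this, of \<psi> B] show ?thesis
        unfolding \<gamma>_def using dB by (simp add: has_derivative_at_withinI)
    qed
    ultimately show "B l \<in> tangent_space (frontier K) p"
      unfolding tangent_space_def using e(1) by blast
  qed
  obtain n where nL: "L = {z. n \<bullet> z = 0}" and nm: "n \<bullet> A m > 0"
  proof -
    have "dim L < DIM('a)" using L(2) DIM_positive[where 'a='a] by linarith
    from lowdim_subset_hyperplane[OF this] obtain a where a: "a \<noteq> 0" "span L \<subseteq> {z. a \<bullet> z = 0}"
      by blast
    have aL: "L = {z. a \<bullet> z = 0}"
    proof (rule subspace_dim_equal[OF L(1)])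
      show "subspace {z. a \<bullet> z = 0}" by (rule subspace_hyperplane)
      show "L \<subseteq> {z. a \<bullet> z = 0}" using a(2) span_superset by blast
      show "dim {z. a \<bullet> z = 0} \<le> dim L" using a(1) L(2) by (simp add: dim_hyperplane)
    qed
    have "A m \<notin> L" using L_tangent[of "A m"] BA unit by auto
    then have "a \<bullet> A m \<noteq> 0" using aL by simp
    then consider "a \<bullet> A m > 0" | "(- a) \<bullet> A m > 0" by fastforce
    then show ?thesis
      using aL that[of a] that[of "- a"] by cases auto
  qed
  \<comment> \<open>\<open>\<beta>\<close> is the multiple of \<open>m\<close> to subtract from \<open>v\<close> so that the rest is mapped into \<open>L\<close>; the rest
      is then tangent, which forces \<open>\<beta>\<close> to be the normal component of \<open>v\<close>.\<close>
  have nv: "n \<bullet> A v > 0"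
  proof -
    define \<beta> where "\<beta> = (n \<bullet> A v) / (n \<bullet> A m)"
    have "A (v - \<beta> *\<^sub>R m) \<in> L"
      using nm unfolding nL
      by (simp add: linear_diff[OF linA] linear_scale[OF linA] inner_diff_right \<beta>_def)
    from L_tangent[OF this] have "m \<bullet> v = \<beta>"
      by (simp add: BA inner_diff_right unit)
    then have "\<beta> > 0" using pos by (simp add: m_def p_def)
    then show ?thesis using nm by (simp add: \<beta>_def zero_less_divide_iff)
  qed
  obtain r where r: "r > 0" "ball (\<phi> p) r \<subseteq> V" using V q(1) open_contains_ball by blast
  define D where "D = ball (\<phi> p) r \<inter> {z. n \<bullet> z > 0}"
  \<comment> \<open>Stated for any curve, because it is used twice: for the normal line at \<open>p\<close>, which shows on which
      side \<open>K\<close> lies, and for \<open>x\<close> itself.\<close>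
  have reaches: "\<forall>\<^sub>F t in at_right a. \<gamma> t \<in> \<psi> ` D"
    if \<gamma>: "(\<gamma> has_vector_derivative w) (at a)" "\<gamma> a = p" "n \<bullet> A w > 0" for \<gamma> w and a :: real
  proof -
    have d: "(\<phi> \<circ> \<gamma> has_vector_derivative A w) (at a)"
      using vector_derivative_diff_chain_within[OF \<gamma>(1), of \<phi> A] dA \<gamma>(2)
      by (simp add: has_derivative_at_withinI)
    have "n \<bullet> (\<phi> \<circ> \<gamma>) a = 0" using q(2) nL \<gamma>(2) by simp
    from crosses_hyperplane[OF d this \<gamma>(3)] have 1: "\<forall>\<^sub>F t in at_right a. n \<bullet> (\<phi> \<circ> \<gamma>) t > 0" .
    have "(\<gamma> \<longlongrightarrow> p) (at_right a)"
      using has_vector_derivative_continuous[OF \<gamma>(1)] \<gamma>(2)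
      by (metis continuous_within filterlim_at_split)
    from topological_tendstoD[OF this U] have 2: "\<forall>\<^sub>F t in at_right a. \<gamma> t \<in> U" .
    have "((\<phi> \<circ> \<gamma>) \<longlongrightarrow> \<phi> p) (at_right a)"
      using has_vector_derivative_continuous[OF d] \<gamma>(2)
      by (metis continuous_within filterlim_at_split comp_apply)
    from topological_tendstoD[OF this open_ball[of "\<phi> p" r]] r(1)
    have 3: "\<forall>\<^sub>F t in at_right a. (\<phi> \<circ> \<gamma>) t \<in> ball (\<phi> p) r" by simp
    show ?thesis
      using 1 2 3
    proof eventually_elim
      case (elim t)
      then have "\<phi> (\<gamma> t) \<in> D" by (simp add: D_def)
      then show ?case using \<psi>\<phi>[OF elim(2)] by (metis image_eqI)
    qed
  qed
  have DV: "D \<subseteq> V" using r(2) by (auto simp: D_def)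
  have conn: "connected (\<psi> ` D)"
  proof (rule connected_continuous_image)
    show "continuous_on D \<psi>" using hom DV continuous_on_subset by (auto simp: homeomorphism_def)
    show "connected D"
      unfolding D_def by (intro convex_connected convex_Int convex_ball convex_halfspace_gt)
  qed
  have disj: "\<psi> ` D \<inter> frontier K = {}"
  proof (rule ccontr)
    assume "\<psi> ` D \<inter> frontier K \<noteq> {}"
    then obtain z where z: "z \<in> D" "\<psi> z \<in> frontier K" by auto
    then have "\<phi> (\<psi> z) \<in> \<phi> ` (U \<inter> frontier K)" using imU DV by blast
    then have "z \<in> L" using flat \<phi>\<psi> z(1) DV by auto
    then show False using z(1) nL by (simp add: D_def)
  qed
  have meet: "\<psi> ` D \<inter> K \<noteq> {}"
  proof -
    obtain e where e: "e > 0" "\<And>t. 0 < t \<Longrightarrow> t < e \<Longrightarrow> p + t *\<^sub>R m \<in> interior K"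
      using nf p unfolding inward_unit_normal_field_def m_def by blast
    have "\<forall>\<^sub>F t in at_right 0. p + t *\<^sub>R m \<in> \<psi> ` D"
      by (rule reaches[OF _ _ nm]) (auto intro!: derivative_eq_intros)
    moreover have "\<forall>\<^sub>F t in at_right 0. p + t *\<^sub>R m \<in> interior K"
      unfolding eventually_at_right_field using e by auto
    ultimately have "\<forall>\<^sub>F t in at_right (0::real). \<psi> ` D \<inter> K \<noteq> {}"
    proof eventually_elim
      case (elim t)
      then show ?case using interior_subset by blast
    qed
    then show ?thesis by simp
  qed
  have "\<psi> ` D \<subseteq> K" using connected_Int_frontier[OF conn meet] disj by blast
  moreover have "\<forall>\<^sub>F t in at_right s. x t \<in> \<psi> ` D"
    by (rule reaches[OF xd _ nv]) (simp add: p_def)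
  ultimately show ?thesis
    by (meson eventually_mono subsetD)
qed

text \<open>
  At the last time before \<open>t\<close> at which the solution is in \<open>K\<close>, it stays in \<open>K\<close> a little longer: trivially
  if it is in the interior, and by the previous lemma if it is on the frontier.
\<close>

lemma positively_invariant_inside_hypersurface:
  fixes K :: "'a::euclidean_space set"
  assumes sm: "smooth_submanifold (DIM('a) - 1) (frontier K)" and "closed K"
    and nf: "inward_unit_normal_field (frontier K) K N"
    and pos: "\<And>y. y \<in> frontier K \<Longrightarrow> N y \<bullet> f y > 0"
    and sol: "solution_on f G J x" and "0 \<in> J" and "x 0 \<in> K" and "t \<in> J" and "0 \<le> t"
  shows "x t \<in> K"
proof -
  have sub: "{0..t} \<subseteq> J"
  proof
    fix r assume "r \<in> {0..t}"
    moreover have "is_interval J" using sol by (simp add: solution_on_def)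
    ultimately show "r \<in> J"
      using assms(6,8) unfolding is_interval_1 by (meson atLeastAtMost_iff)
  qed
  define S where "S = {r \<in> {0..t}. x r \<in> K}"
  have "continuous_on {0..t} x" using solution_on_continuous[OF sol] sub continuous_on_subset by blast
  then have "closed S"
    unfolding S_def using continuous_closed_preimage[of "{0..t}" x K] assms(2)
    by (simp add: vimage_def Int_def)
  moreover have ne: "S \<noteq> {}" and bdd: "bdd_above S"
    using assms(7,9) unfolding S_def by (auto intro!: bdd_aboveI[of _ t])
  ultimately have sS: "Sup S \<in> S" using closed_contains_Sup by blast
  define s where "s = Sup S"
  have s: "0 \<le> s" "s \<le> t" "x s \<in> K" using sS by (auto simp: S_def s_def)
  have der: "(x has_vector_derivative f (x s)) (at s)"
    using sol sub s unfolding solution_on_def by auto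
  have "s = t"
  proof (rule ccontr)
    assume "s \<noteq> t"
    then have "s < t" using s by simp
    have "\<forall>\<^sub>F r in at_right s. x r \<in> K"
    proof (cases "x s \<in> frontier K")
      case True
      then show ?thesis using enters_across_hypersurface[OF sm nf True der] pos by blast
    next
      case False
      then have "x s \<in> interior K" using s(3) by (simp add: frontier_def closure_closed \<open>closed K\<close>)
      moreover have "(x \<longlongrightarrow> x s) (at_right s)"
        using has_vector_derivative_continuous[OF der]
        by (metis continuous_within filterlim_at_split)
      ultimately have "\<forall>\<^sub>F r in at_right s. x r \<in> interior K"
        using topological_tendstoD open_interior by blast
      then show ?thesis by eventually_elim (use interior_subset in blast)
    qed
    moreover have "\<forall>\<^sub>F r in at_right s. r \<in> {s<..<t}"
      using \<open>s < t\<close> by (rule eventually_at_right_real)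
    ultimately have "\<forall>\<^sub>F r in at_right s. r \<in> S \<and> s < r"
      by eventually_elim (use s(1) in \<open>auto simp: S_def\<close>)
    then obtain r where "r \<in> S" "s < r" using eventually_happens' trivial_limit_at_right_real by blast
    then show False using cSup_upper[OF _ bdd] unfolding s_def by fastforce
  qed
  then show ?thesis using s(3) by simp
qed

section \<open>Solutions that stay in a compact set\<close>

lemma continuous_on_compact_norm_bound:
  assumes "continuous_on G f" and "compact K" and "K \<subseteq> G"
  obtains L :: real where "L > 0" "\<And>y. y \<in> K \<Longrightarrow> norm (f y) \<le> L"
proof -
  have "bounded (f ` K)"
    using assms compact_continuous_image compact_imp_bounded continuous_on_subset by metis
  then show ?thesis using that unfolding bounded_pos by auto
qed

text \<open>
  If the domain had a finite right end \<open>b\<close>, the curve, being Lipschitz, would extend continuously to \<open>b\<close>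
  with a value \<open>q\<close> in \<open>K\<close>. Following it by the phase curve of \<open>q\<close> gives a longer solution, against
  maximality. The only delicate point is that the joined curve is differentiable at \<open>b\<close>: its velocity
  tends to \<open>f q\<close> from the left by continuity of \<open>f\<close>.
\<close>

lemma confined_phase_curve_is_global:
  fixes f :: "'a::euclidean_space \<Rightarrow> 'a"
  assumes contf: "continuous_on G f" and uniq: "unique_phase_curves f G"
    and K: "compact K" "K \<subseteq> G"
    and pc: "phase_curve f G p J x" and stay: "\<And>t. t \<in> J \<Longrightarrow> 0 \<le> t \<Longrightarrow> x t \<in> K"
  shows "{0..} \<subseteq> J"
proof (rule ccontr)
  assume "\<not> {0..} \<subseteq> J"
  then obtain c where c: "c \<ge> 0" "c \<notin> J" by auto
  have sol: "solution_on f G J x" and J0: "0 \<in> J"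
    and maxim: "\<And>J' y. solution_on f G J' y \<Longrightarrow> J \<subseteq> J' \<Longrightarrow> (\<forall>t\<in>J. y t = x t) \<Longrightarrow> J' = J"
    using pc unfolding phase_curve_def by auto
  have J: "open J" "\<And>a b t. a \<in> J \<Longrightarrow> b \<in> J \<Longrightarrow> a \<le> t \<Longrightarrow> t \<le> b \<Longrightarrow> t \<in> J"
    and xG: "\<And>t. t \<in> J \<Longrightarrow> x t \<in> G"
    and xd: "\<And>t. t \<in> J \<Longrightarrow> (x has_vector_derivative f (x t)) (at t)"
    using sol unfolding solution_on_def is_interval_1 by blast+
  have Jc: "t < c" if "t \<in> J" for t
    using J(2)[OF J0 that c(1)] c(2) by fastforce
  then have bdd: "bdd_above J" by (meson bdd_aboveI less_imp_le)
  define b where "b = Sup J"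
  have ball_J: "\<exists>e>0. \<forall>r. \<bar>r - t\<bar> < e \<longrightarrow> r \<in> J" if "t \<in> J" for t
    using J(1) that unfolding open_dist by (auto simp: dist_real_def)
  have Jb: "t < b" if t: "t \<in> J" for t
  proof -
    obtain e where e: "e > 0" "\<forall>r. \<bar>r - t\<bar> < e \<longrightarrow> r \<in> J" using ball_J[OF t] by blast
    then have "t + e / 2 \<in> J" by simp
    then show ?thesis using cSup_upper[OF _ bdd] e(1) unfolding b_def by fastforce
  qed
  have b0: "0 < b" using Jb J0 by blast
  have inJ: "t \<in> J" if t: "0 \<le> t" "t < b" for t
  proof -
    obtain u where "u \<in> J" "t < u" using less_cSupD[of J t] t(2) J0 b_def by blast
    then show ?thesis using J(2)[OF J0] t(1) by simp
  qed
  obtain L where L: "L > 0" "\<And>y. y \<in> K \<Longrightarrow> norm (f y) \<le> L"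
    using continuous_on_compact_norm_bound[OF contf K] by blast
  have lip: "norm (x t - x s) \<le> L * (t - s)" if "0 \<le> s" "s \<le> t" "t < b" for s t
    by (rule solution_on_lipschitz[OF sol]) (use that inJ stay L in auto)
  have "L-lipschitz_on {0..<b} x"
  proof (rule lipschitz_onI)
    fix s t assume st: "s \<in> {0..<b}" "t \<in> {0..<b}"
    show "dist (x s) (x t) \<le> L * dist s t"
      using lip[of s t] lip[of t s] st
      by (cases "s \<le> t") (auto simp: dist_norm norm_minus_commute abs_if)
  qed (use L in simp)
  from lipschitz_extend_closure[OF this] obtain g
    where "L-lipschitz_on (closure {0..<b}) g" and gx: "\<And>t. t \<in> {0..<b} \<Longrightarrow> g t = x t" by blast
  then have contg: "continuous_on {0..b} g"
    using lipschitz_on_continuous_on b0 by force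
  define q where "q = g b"
  have "g ` closure {0..<b} \<subseteq> K"
    by (rule image_closure_subset)
      (use contg b0 K(1) stay inJ gx compact_imp_closed in auto)
  then have qK: "q \<in> K" using b0 by (auto simp: q_def)
  then have qG: "q \<in> G" using K by blast
  obtain Jz z where pcz: "phase_curve f G q Jz z"
    using uniq qG unfolding unique_phase_curves_def by blast
  then have z0: "z 0 = q" "0 \<in> Jz" and Jz: "open Jz"
    and zG: "\<And>t. t \<in> Jz \<Longrightarrow> z t \<in> G"
    and zd: "\<And>t. t \<in> Jz \<Longrightarrow> (z has_vector_derivative f (z t)) (at t)"
    unfolding phase_curve_def solution_on_def by blast+
  obtain e where e: "e > 0" "\<And>r. \<bar>r\<bar> < e \<Longrightarrow> r \<in> Jz"
    using Jz z0(2) unfolding open_dist by (force simp: dist_real_def)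
  define y where "y = (\<lambda>t. if t < b then x t else z (t - b))"
  have yg: "y t = g t" if "t \<in> {0..b}" for t
    using that gx z0 by (auto simp: y_def q_def)
  have conty: "continuous_on {0..b} y"
    by (rule continuous_on_eq[OF contg]) (simp only: yg)
  have dq: "(y has_vector_derivative f q) (at b)"
    unfolding has_vector_derivative_def has_derivative_at_alt
  proof (intro conjI allI impI)
    show "bounded_linear (\<lambda>h. h *\<^sub>R f q)" by (rule bounded_linear_scaleR_left)
    fix \<epsilon> :: real assume \<epsilon>: "\<epsilon> > 0"
    have "(z has_derivative (\<lambda>h. h *\<^sub>R f q)) (at 0)"
      using zd[OF z0(2)] z0(1) by (simp add: has_vector_derivative_def)
    then obtain d1 where d1: "d1 > 0"
      "\<And>h. norm (h - 0) < d1 \<Longrightarrow> norm (z h - z 0 - (h - 0) *\<^sub>R f q) \<le> \<epsilon> * norm (h - 0)"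
      unfolding has_derivative_at_alt using \<epsilon> by blast
    obtain d0 where d0: "d0 > 0" "\<And>u. u \<in> G \<Longrightarrow> dist u q < d0 \<Longrightarrow> dist (f u) (f q) < \<epsilon>"
      using contf qG \<epsilon> unfolding continuous_on_iff by blast
    obtain d2 where d2: "d2 > 0" "\<And>t. t \<in> {0..b} \<Longrightarrow> dist t b < d2 \<Longrightarrow> dist (y t) (y b) < d0"
      using conty b0 d0(1) unfolding continuous_on_iff by (metis atLeastAtMost_iff less_eq_real_def)
    define d where "d = min d1 (min d2 b)"
    have yb: "y b = q" by (simp add: y_def z0)
    show "\<exists>d>0. \<forall>t. norm (t - b) < d \<longrightarrow> norm (y t - y b - (t - b) *\<^sub>R f q) \<le> \<epsilon> * norm (t - b)"
    proof (intro exI[of _ d] conjI allI impI)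
      show "d > 0" using d1 d2 b0 by (simp add: d_def)
      fix t assume t: "norm (t - b) < d"
      show "norm (y t - y b - (t - b) *\<^sub>R f q) \<le> \<epsilon> * norm (t - b)"
      proof (cases "t < b")
        case False
        then show ?thesis using d1(2)[of "t - b"] t by (simp add: y_def d_def)
      next
        case True
        then have t0: "0 \<le> t" using t by (auto simp: d_def)
        have "norm (y b - y t - (b - t) *\<^sub>R f q) \<le> \<epsilon> * (b - t)"
        proof (rule linear_approximation_bound[where x' = "\<lambda>r. f (x r)"])
          show "continuous_on {t..b} y" using conty t0 continuous_on_subset by fastforce
          fix r assume r: "t < r" "r < b"
          then have rJ: "r \<in> J" using inJ t0 by simp
          show "(y has_vector_derivative f (x r)) (at r)"
            by (rule has_vector_derivative_transform_within_open[OF xd[OF rJ], of "{..<b}"])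
              (use r in \<open>auto simp: y_def\<close>)
          have "dist (y r) (y b) < d0"
            using d2(2)[of r] r t t0 by (auto simp: d_def dist_real_def)
          then show "norm (f (x r) - f q) \<le> \<epsilon>"
            using d0(2)[OF xG[OF rJ]] r yb by (simp add: y_def dist_norm)
        qed (use True in simp)
        moreover have "norm (y b - y t - (b - t) *\<^sub>R f q) = norm (y t - y b - (t - b) *\<^sub>R f q)"
          by (subst norm_minus_cancel[symmetric]) (simp add: algebra_simps)
        ultimately show ?thesis using True by simp
      qed
    qed
  qed
  define J' where "J' = J \<union> {0<..<b + e}"
  have "solution_on f G J' y"
    unfolding solution_on_def
  proof (intro conjI ballI)
    show "open J'" unfolding J'_def using J(1) by auto
    have "b / 2 \<in> J \<inter> {0<..<b + e}" using inJ b0 e by auto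
    moreover have "connected J" using sol by (simp add: solution_on_def is_interval_connected_1)
    ultimately show "is_interval J'"
      unfolding J'_def is_interval_connected_1 by (intro connected_Un) auto
  next
    fix t assume t: "t \<in> J'"
    have cases: "t < b \<and> t \<in> J \<or> t = b \<or> b < t \<and> t - b \<in> Jz"
    proof (cases "t < b")
      case True
      then show ?thesis using t inJ[of t] unfolding J'_def by auto
    next
      case False
      then have "t < b + e" using t Jb[of t] unfolding J'_def by auto
      then show ?thesis using False e(2)[of "t - b"] by (cases "t = b") auto
    qed
    then show "y t \<in> G" using xG zG z0 qG by (auto simp: y_def)
    from cases show "(y has_vector_derivative f (y t)) (at t)"
    proof (elim disjE conjE)
      assume "t < b" "t \<in> J"
      then show ?thesis
        using has_vector_derivative_transform_within_open[OF xd, of t "{..<b}" y]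
        by (simp add: y_def)
    next
      assume "t = b"
      then show ?thesis using dq by (simp add: y_def z0)
    next
      assume tb: "b < t" "t - b \<in> Jz"
      have "(z \<circ> (\<lambda>t. t - b) has_vector_derivative 1 *\<^sub>R f (z (t - b))) (at t)"
      proof (rule vector_diff_chain_at)
        show "((\<lambda>t. t - b) has_vector_derivative 1) (at t)"
          by (auto intro!: derivative_eq_intros)
      qed (rule zd[OF tb(2)])
      then have "(z \<circ> (\<lambda>t. t - b) has_vector_derivative f (y t)) (at t)"
        using tb(1) by (simp add: y_def)
      then show ?thesis
        by (rule has_vector_derivative_transform_within_open[where S = "{b<..}"])
          (use tb(1) in \<open>simp_all add: y_def\<close>)
    qed
  qed
  then have "J' = J"
    by (rule maxim) (auto simp: J'_def y_def Jb)
  then have "b \<in> J" using b0 e unfolding J'_def by auto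
  then show False using Jb by blast
qed

section \<open>Omega-limit sets\<close>

definition omega_limit :: "(real \<Rightarrow> 'a::topological_space) \<Rightarrow> 'a set" where
  "omega_limit x =
     {y. \<exists>\<tau>. filterlim \<tau> at_top sequentially \<and> (\<lambda>k::nat. x (\<tau> k)) \<longlonglongrightarrow> y}"

text \<open>
  With \<open>C\<close> a trapping set this gives limit points at all; with \<open>C\<close> what remains of a trapping set after
  removing a neighbourhood of \<open>q\<close>, it gives limit points other than \<open>q\<close> when the curve does not
  converge to \<open>q\<close>.
\<close>

lemma omega_limit_meets_compact:
  fixes x :: "real \<Rightarrow> 'a::metric_space"
  assumes "compact C" and "\<exists>\<^sub>F t in at_top. x t \<in> C"
  shows "omega_limit x \<inter> C \<noteq> {}"
proof -
  have "\<exists>t\<ge>real n. x t \<in> C" for n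
    using assms(2) by (auto simp: frequently_def eventually_at_top_linorder)
  then obtain \<tau> where \<tau>: "\<And>n. \<tau> n \<ge> real n" "\<And>n. x (\<tau> n) \<in> C" by metis
  then obtain l r where l: "l \<in> C" "strict_mono r" "((\<lambda>n. x (\<tau> n)) \<circ> r) \<longlonglongrightarrow> l"
    using assms(1) unfolding compact_def by (metis (no_types, lifting))
  have "filterlim \<tau> at_top sequentially"
    by (rule filterlim_at_top_mono[OF filterlim_real_sequentially]) (simp add: \<tau>)
  then have "filterlim (\<tau> \<circ> r) at_top sequentially"
    unfolding comp_def using filterlim_compose filterlim_subseq[OF l(2)] by blast
  then show ?thesis
    using l unfolding omega_limit_def comp_def by blast
qed

lemma omega_limit_subset_closed:
  fixes x :: "real \<Rightarrow> 'a::metric_space"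
  assumes "closed C" and "\<And>t. t \<ge> 0 \<Longrightarrow> x t \<in> C"
  shows "omega_limit x \<subseteq> C"
proof
  fix y assume "y \<in> omega_limit x"
  then obtain \<tau> where \<tau>: "filterlim \<tau> at_top sequentially" "(\<lambda>k::nat. x (\<tau> k)) \<longlonglongrightarrow> y"
    unfolding omega_limit_def by blast
  have "\<forall>\<^sub>F k in sequentially. x (\<tau> k) \<in> C"
    using filterlim_at_top[THEN iffD1, OF \<tau>(1), rule_format, of 0]
    by eventually_elim (rule assms(2))
  then show "y \<in> C"
    using Lim_in_closed_set[OF assms(1) _ _ \<tau>(2)] by simp
qed

lemma tendsto_unique_omega_limit:
  fixes x :: "real \<Rightarrow> 'a::metric_space"
  assumes "compact C" and "\<And>t. t \<ge> 0 \<Longrightarrow> x t \<in> C" and "omega_limit x \<subseteq> {q}"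
  shows "(x \<longlongrightarrow> q) at_top"
proof (rule topological_tendstoI, rule ccontr)
  fix S assume S: "open S" "q \<in> S" "\<not> (\<forall>\<^sub>F t in at_top. x t \<in> S)"
  then have "\<exists>\<^sub>F t in at_top. x t \<notin> S" by (simp add: not_eventually)
  then have "\<exists>\<^sub>F t in at_top. x t \<in> C - S"
    by (rule frequently_elim1[OF frequently_eventually_frequently[OF _ eventually_ge_at_top[of 0]]])
      (use assms(2) in auto)
  then have "omega_limit x \<inter> (C - S) \<noteq> {}"
    using omega_limit_meets_compact compact_diff[OF assms(1) S(1)] by blast
  then show False using assms(3) S(2) by blast
qed

text \<open>
  For a limit point \<open>y\<close> of \<open>x\<close> along times \<open>\<tau> k\<close>, the curves \<open>r \<mapsto> x (\<tau> k + r)\<close> lie in \<open>K\<close> and share the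
  Lipschitz constant \<open>L\<close>. A diagonal subsequence converges at all rational \<open>r\<close>, hence by the Lipschitz
  bound at all real \<open>r\<close>. The limit \<open>z\<close> is a solution defined for all times with \<open>z 0 = y\<close>; a solution
  on the whole line is maximal, so it is the phase curve of \<open>y\<close>. Its values are limit points of \<open>x\<close>
  along the shifted times.
\<close>

lemma omega_limit_invariant:
  fixes f :: "'a::euclidean_space \<Rightarrow> 'a"
  assumes contf: "continuous_on G f" and uniq: "unique_phase_curves f G"
    and K: "compact K" "K \<subseteq> G"
    and sol: "solution_on f G J x" and J: "{0..} \<subseteq> J" and stay: "\<And>t. 0 \<le> t \<Longrightarrow> x t \<in> K"
  shows "invariant_set f G (omega_limit x)"
proof -
  have clK: "closed K" using K(1) by (rule compact_imp_closed)
  have \<omega>G: "omega_limit x \<subseteq> G"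
    by (rule order_trans[OF omega_limit_subset_closed[OF clK stay] K(2)])
  have xd: "\<And>t. 0 \<le> t \<Longrightarrow> (x has_vector_derivative f (x t)) (at t)"
    using sol subsetD[OF J] by (simp add: solution_on_def)
  obtain L where L: "L > 0" "\<And>y. y \<in> K \<Longrightarrow> norm (f y) \<le> L"
    using continuous_on_compact_norm_bound[OF contf K] by blast
  have lip: "norm (x t - x s) \<le> L * \<bar>t - s\<bar>" if "0 \<le> s" "0 \<le> t" for s t
  proof -
    have "norm (x t - x s) \<le> L * (t - s)" if "0 \<le> s" "s \<le> t" for s t
      by (rule solution_on_lipschitz[OF sol]) (use that J stay L in auto)
    from this[of s t] this[of t s] that show ?thesis
      by (cases "s \<le> t") (auto simp: norm_minus_commute)
  qed
  have orbit: "\<exists>z. solution_on f G UNIV z \<and> z 0 = y \<and> (\<forall>t. z t \<in> omega_limit x)"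
    if y: "y \<in> omega_limit x" for y
  proof -
    obtain \<tau> where \<tau>: "filterlim \<tau> at_top sequentially" "(\<lambda>k::nat. x (\<tau> k)) \<longlonglongrightarrow> y"
      using y unfolding omega_limit_def by blast
    \<comment> \<open>Truncating at time 0 keeps every \<open>F k\<close> in \<open>K\<close> and \<open>L\<close>-Lipschitz on the whole line; for fixed \<open>r\<close>
        it has no effect once \<open>k\<close> is large.\<close>
    define F where "F = (\<lambda>k r. x (max 0 (\<tau> k + r)))"
    have FK: "F k r \<in> K" for k r by (simp add: F_def stay)
    obtain Bd where Bd: "\<And>u. u \<in> K \<Longrightarrow> norm u \<le> Bd"
      using compact_imp_bounded[OF K(1)] unfolding bounded_iff by blast
    have Flip: "norm (F k r - F k s) \<le> L * \<bar>r - s\<bar>" for k r s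
    proof -
      have "norm (F k r - F k s) \<le> L * \<bar>max 0 (\<tau> k + r) - max 0 (\<tau> k + s)\<bar>"
        unfolding F_def by (rule lip) auto
      also have "\<dots> \<le> L * \<bar>r - s\<bar>" using L(1) by (intro mult_left_mono) auto
      finally show ?thesis .
    qed
    obtain \<kappa> where \<kappa>: "strict_mono (\<kappa>::nat\<Rightarrow>nat)"
      and convQ: "\<And>r. r \<in> \<rat> \<Longrightarrow> \<exists>l. (\<lambda>n. F (\<kappa> n) r) \<longlonglongrightarrow> l"
      using function_convergent_subsequence[of "\<rat>" F Bd] countable_rat Bd FK by metis
    have conv: "convergent (\<lambda>n. F (\<kappa> n) r)" for r
    proof (rule Cauchy_convergent, rule metric_CauchyI)
      fix \<epsilon> :: real assume \<epsilon>: "\<epsilon> > 0"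
      define d where "d = \<epsilon> / (3 * L)"
      have d: "d > 0" "L * d = \<epsilon> / 3" using \<epsilon> L(1) by (auto simp: d_def)
      obtain s where s: "s \<in> \<rat>" "r < s" "s < r + d"
        using Rats_dense_in_real[of r "r + d"] d(1) by auto
      have near: "dist (F (\<kappa> n) r) (F (\<kappa> n) s) < \<epsilon> / 3" for n
      proof -
        have "dist (F (\<kappa> n) r) (F (\<kappa> n) s) \<le> L * \<bar>r - s\<bar>" using Flip by (simp add: dist_norm)
        also have "\<dots> < L * d" using s L(1) by (intro mult_strict_left_mono) auto
        finally show ?thesis using d by simp
      qed
      have "Cauchy (\<lambda>n. F (\<kappa> n) s)" using convQ[OF s(1)] LIMSEQ_imp_Cauchy by blast
      then obtain M where M: "\<And>m n. m \<ge> M \<Longrightarrow> n \<ge> M \<Longrightarrow> dist (F (\<kappa> m) s) (F (\<kappa> n) s) < \<epsilon> / 3"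
        using metric_CauchyD[of _ "\<epsilon> / 3"] \<epsilon> by (metis divide_pos_pos zero_less_numeral)
      show "\<exists>M. \<forall>m\<ge>M. \<forall>n\<ge>M. dist (F (\<kappa> m) r) (F (\<kappa> n) r) < \<epsilon>"
      proof (intro exI[of _ M] allI impI)
        fix m n assume "m \<ge> M" "n \<ge> M"
        then have "dist (F (\<kappa> m) s) (F (\<kappa> n) s) < \<epsilon> / 3" by (rule M)
        moreover have "dist (F (\<kappa> n) s) (F (\<kappa> n) r) < \<epsilon> / 3" using near[of n] by (simp add: dist_commute)
        ultimately have "dist (F (\<kappa> m) r) (F (\<kappa> n) r) < \<epsilon> / 3 + \<epsilon> / 3 + \<epsilon> / 3"
          using near[of m] dist_triangle[of "F (\<kappa> m) r" "F (\<kappa> n) r" "F (\<kappa> m) s"]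
            dist_triangle[of "F (\<kappa> m) s" "F (\<kappa> n) r" "F (\<kappa> n) s"] by linarith
        then show "dist (F (\<kappa> m) r) (F (\<kappa> n) r) < \<epsilon>" by simp
      qed
    qed
    define z where "z = (\<lambda>r. lim (\<lambda>n. F (\<kappa> n) r))"
    have zlim: "(\<lambda>n. F (\<kappa> n) r) \<longlonglongrightarrow> z r" for r
      using conv[of r] by (simp add: z_def convergent_LIMSEQ_iff)
    have \<tau>\<kappa>: "filterlim (\<lambda>n. \<tau> (\<kappa> n)) at_top sequentially"
      using filterlim_compose[OF \<tau>(1) filterlim_subseq[OF \<kappa>]] .
    have \<tau>pos: "\<forall>\<^sub>F n in sequentially. c \<le> \<tau> (\<kappa> n)" for c
      using \<tau>\<kappa> by (simp add: filterlim_at_top)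
    have xlim: "(\<lambda>n. x (\<tau> (\<kappa> n) + r)) \<longlonglongrightarrow> z r" for r
    proof (rule Lim_transform_eventually[OF zlim])
      show "\<forall>\<^sub>F n in sequentially. F (\<kappa> n) r = x (\<tau> (\<kappa> n) + r)"
        using \<tau>pos[of "- r"] by eventually_elim (simp add: F_def max_def)
    qed
    have z\<omega>: "z r \<in> omega_limit x" for r
    proof -
      have "filterlim (\<lambda>n. \<tau> (\<kappa> n) + r) at_top sequentially"
        using filterlim_tendsto_add_at_top[OF tendsto_const[of r] \<tau>\<kappa>] by (simp add: add.commute)
      then show ?thesis unfolding omega_limit_def using xlim[of r] by blast
    qed
    have z0: "z 0 = y"
      using LIMSEQ_unique[OF xlim[of 0]] LIMSEQ_subseq_LIMSEQ[OF \<tau>(2) \<kappa>] by (simp add: comp_def)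
    have "(z has_vector_derivative f (z s)) (at s)" for s
      unfolding has_vector_derivative_def has_derivative_at_alt
    proof (intro conjI allI impI)
      show "bounded_linear (\<lambda>h. h *\<^sub>R f (z s))" by (rule bounded_linear_scaleR_left)
      fix \<epsilon> :: real assume \<epsilon>: "\<epsilon> > 0"
      have zsG: "z s \<in> G" using z\<omega> \<omega>G by blast
      then obtain d0 where d0: "d0 > 0" "\<And>u. u \<in> G \<Longrightarrow> dist u (z s) < d0 \<Longrightarrow> dist (f u) (f (z s)) < \<epsilon>"
        using contf \<epsilon> unfolding continuous_on_iff by blast
      \<comment> \<open>Half of \<open>d0\<close> bounds the motion of the shifted curve during a time \<open>d\<close>, the other half its
          distance from \<open>z s\<close> at time \<open>s\<close>.\<close>
      define d where "d = d0 / (2 * L)"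
      have d: "d > 0" "L * d = d0 / 2" using d0 L(1) by (auto simp: d_def)
      have approx: "norm (z t - z t' - (t - t') *\<^sub>R f (z s)) \<le> \<epsilon> * (t - t')"
        if t: "t' \<le> t" "\<bar>t - s\<bar> < d" "\<bar>t' - s\<bar> < d" for t t'
      proof (rule Lim_norm_ubound[OF sequentially_bot])
        show "(\<lambda>n. x (\<tau> (\<kappa> n) + t) - x (\<tau> (\<kappa> n) + t') - (t - t') *\<^sub>R f (z s))
               \<longlonglongrightarrow> z t - z t' - (t - t') *\<^sub>R f (z s)"
          by (intro tendsto_intros xlim)
        have "\<forall>\<^sub>F n in sequentially. dist (x (\<tau> (\<kappa> n) + s)) (z s) < d0 / 2"
          using tendstoD[OF xlim[of s], of "d0 / 2"] d0(1) by simp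
        then show "\<forall>\<^sub>F n in sequentially.
            norm (x (\<tau> (\<kappa> n) + t) - x (\<tau> (\<kappa> n) + t') - (t - t') *\<^sub>R f (z s)) \<le> \<epsilon> * (t - t')"
          using \<tau>pos[of "- t'"] \<tau>pos[of "- s"]
        proof eventually_elim
          case (elim n)
          define a where "a = \<tau> (\<kappa> n)"
          have "norm (x (a + t) - x (a + t') - ((a + t) - (a + t')) *\<^sub>R f (z s))
                  \<le> \<epsilon> * ((a + t) - (a + t'))"
          proof (rule linear_approximation_bound[where x' = "\<lambda>r. f (x r)"])
            show "continuous_on {a + t'..a + t} x"
              using elim J
              by (intro continuous_on_subset[OF solution_on_continuous[OF sol]]) (auto simp: a_def)
            fix r assume r: "a + t' < r" "r < a + t"
            then have r0: "0 \<le> r" using elim by (simp add: a_def)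
            show "(x has_vector_derivative f (x r)) (at r)" by (rule xd[OF r0])
            have "norm (x r - x (a + s)) \<le> L * \<bar>r - (a + s)\<bar>"
              by (rule lip) (use elim r0 in \<open>auto simp: a_def\<close>)
            also have "\<dots> \<le> L * d"
              using r t L(1) by (intro mult_left_mono) auto
            finally have "dist (x r) (x (a + s)) \<le> d0 / 2" using d by (simp add: dist_norm)
            then have "dist (x r) (z s) < d0"
              using elim(1) dist_triangle[of "x r" "z s" "x (a + s)"] unfolding a_def by linarith
            then show "norm (f (x r) - f (z s)) \<le> \<epsilon>"
              using d0(2)[of "x r"] stay[OF r0] K(2) by (auto simp: dist_norm)
          qed (use t in simp)
          then show ?case by (simp add: a_def)
        qed
      qed
      show "\<exists>d>0. \<forall>t. norm (t - s) < d \<longrightarrow>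
              norm (z t - z s - (t - s) *\<^sub>R f (z s)) \<le> \<epsilon> * norm (t - s)"
      proof (intro exI[of _ d] conjI allI impI)
        fix t assume t: "norm (t - s) < d"
        show "norm (z t - z s - (t - s) *\<^sub>R f (z s)) \<le> \<epsilon> * norm (t - s)"
        proof (cases "s \<le> t")
          case True
          then show ?thesis using approx[of s t] t d by simp
        next
          case False
          have "norm (z s - z t - (s - t) *\<^sub>R f (z s)) = norm (z t - z s - (t - s) *\<^sub>R f (z s))"
            by (subst norm_minus_cancel[symmetric]) (simp add: algebra_simps)
          then show ?thesis using False approx[of t s] t d by simp
        qed
      qed (rule d)
    qed
    then have "solution_on f G UNIV z"
      unfolding solution_on_def using z\<omega> \<omega>G by (auto simp: is_interval_univ)
    then show ?thesis using z0 z\<omega> by blast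
  qed
  show ?thesis
    unfolding invariant_set_def
  proof (intro conjI ballI allI impI)
    show "omega_limit x \<subseteq> G" by (rule \<omega>G)
  next
    fix y I w assume y: "y \<in> omega_limit x" and w: "phase_curve f G y I w"
    obtain z where z: "solution_on f G UNIV z" "z 0 = y" "\<And>t. z t \<in> omega_limit x"
      using orbit[OF y] by blast
    have "phase_curve f G y UNIV z" unfolding phase_curve_def using z by auto
    then have "I = UNIV \<and> (\<forall>t. w t = z t)"
      using uniq w y \<omega>G unfolding unique_phase_curves_def by (metis UNIV_I subsetD)
    then show "I = UNIV" "w t \<in> omega_limit x" for t using z(3) by auto
  qed
qed

section \<open>Asymptotic stability\<close>

lemma compact_decreasing_subset_open:
  fixes K :: "nat \<Rightarrow> 'a::heine_borel set"
  assumes "\<And>i. compact (K i)" and "\<And>i j. i < j \<Longrightarrow> K j \<subseteq> K i"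
    and "open S" and "(\<Inter>i. K i) \<subseteq> S"
  obtains i where "K i \<subseteq> S"
proof (rule ccontr)
  assume "\<not> thesis"
  then have ne: "K i - S \<noteq> {}" for i using that by blast
  have "\<Inter> (range (\<lambda>i. K i - S)) \<noteq> {}"
  proof (rule compact_nest)
    show "K n - S \<subseteq> K m - S" if "m \<le> n" for m n
      using assms(2)[of m n] that by (cases "m = n") auto
  qed (use ne assms in \<open>auto intro: compact_diff\<close>)
  then show False using assms(4) by auto
qed

theorem theorem4p2:
  fixes f :: "real^'n \<Rightarrow> real^'n" and G :: "(real^'n) set"
    and H K :: "nat \<Rightarrow> (real^'n) set"
    and N :: "nat \<Rightarrow> real^'n \<Rightarrow> real^'n"
  assumes "0 \<in> interior G"
    and "continuous_on G f"
    and "unique_phase_curves f G"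
    and "isolated_equilibrium f G 0"
    and "convergent_hypersurfaces G H K"
    and "\<And>i. inward_unit_normal_field (H i) (K i) (N i)"
    and "\<And>i x. x \<in> H i \<Longrightarrow> N i x \<bullet> f x > 0"
    and "{M. M \<noteq> {} \<and> invariant_set f G M} = {{0}}"
  shows "asymptotically_stable f G 0"
proof -
  have H: "smooth_submanifold (DIM(real^'n) - 1) (H i)" "0 \<notin> H i"
    and K: "compact (K i)" "0 \<in> K i" "frontier (K i) = H i" for i
    using assms(5) by (simp_all add: convergent_hypersurfaces_def restricts_origin_def)
  have nested: "\<And>i j. i < j \<Longrightarrow> K j \<subseteq> K i" and inter: "(\<Inter>i. K i) = {0}"
    using assms(5) by (simp_all add: convergent_hypersurfaces_def)
  have small: "\<exists>i. K i \<subseteq> S" if S: "open S" "0 \<in> S" for S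
  proof -
    have "(\<Inter>i. K i) \<subseteq> S" using S(2) by (simp add: inter)
    from compact_decreasing_subset_open[OF K(1) nested S(1) this] show ?thesis by blast
  qed
  have nbhd: "\<exists>\<delta>>0. ball 0 \<delta> \<subseteq> K i" for i
  proof -
    have "0 \<in> interior (K i)" using K[of i] H(2)[of i] closure_subset by (auto simp: frontier_def)
    then show ?thesis by (simp add: mem_interior)
  qed
  have trapped: "{0..} \<subseteq> J \<and> (\<forall>t\<ge>0. x t \<in> K i)"
    if "K i \<subseteq> G" "p \<in> K i" "phase_curve f G p J x" for i p J x
  proof -
    have sol: "solution_on f G J x" "0 \<in> J" "x 0 \<in> K i"
      using that unfolding phase_curve_def by auto
    have stay: "x t \<in> K i" if "t \<in> J" "0 \<le> t" for t
      by (rule positively_invariant_inside_hypersurface[where N = "N i" and f = f and G = G and J = J])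
        (use H K assms(6,7) sol that in \<open>auto intro: compact_imp_closed\<close>)
    have "{0..} \<subseteq> J"
      by (rule confined_phase_curve_is_global[OF assms(2,3) K(1) that(1,3) stay])
    then show ?thesis using stay by auto
  qed
  have stable: "lyapunov_stable f G 0"
    unfolding lyapunov_stable_def
  proof (intro allI impI)
    fix \<epsilon> :: real assume "\<epsilon> > 0"
    then obtain i where i: "K i \<subseteq> ball 0 \<epsilon> \<inter> interior G"
      using small[of "ball 0 \<epsilon> \<inter> interior G"] assms(1) by auto
    obtain \<delta> where \<delta>: "\<delta> > 0" "ball 0 \<delta> \<subseteq> K i" using nbhd by blast
    have "{0..} \<subseteq> J \<and> (\<forall>t\<ge>0. dist (x t) 0 < \<epsilon>)"
      if "dist p 0 < \<delta>" "phase_curve f G p J x" for p J x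
      using trapped[of i p J x] that i \<delta>(2) interior_subset[of G]
      by (auto simp: subset_iff)
    then show "\<exists>\<delta>>0. \<forall>p\<in>G. dist p 0 < \<delta> \<longrightarrow>
        (\<forall>J x. phase_curve f G p J x \<longrightarrow> {0..} \<subseteq> J \<and> (\<forall>t\<ge>0. dist (x t) 0 < \<epsilon>))"
      using \<delta>(1) by blast
  qed
  obtain m where m: "K m \<subseteq> G" using small[of "interior G"] assms(1) interior_subset by blast
  obtain \<delta> where \<delta>: "\<delta> > 0" "ball 0 \<delta> \<subseteq> K m" using nbhd by blast
  have "{0..} \<subseteq> J \<and> (x \<longlongrightarrow> 0) at_top"
    if "dist p 0 < \<delta>" and pc: "phase_curve f G p J x" for p J x
  proof -
    have tr: "{0..} \<subseteq> J" "\<And>t. 0 \<le> t \<Longrightarrow> x t \<in> K m"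
      using trapped[OF m _ pc] that \<delta>(2) by (auto simp: subset_iff)
    have "solution_on f G J x" using pc by (simp add: phase_curve_def)
    from omega_limit_invariant[OF assms(2,3) K(1) m this tr]
    have "omega_limit x \<noteq> {} \<Longrightarrow> omega_limit x \<in> {M. M \<noteq> {} \<and> invariant_set f G M}"
      by simp
    then have "omega_limit x \<subseteq> {0}" unfolding assms(8) by auto
    from tendsto_unique_omega_limit[OF K(1) tr(2) this] tr(1) show ?thesis by simp
  qed
  then show ?thesis
    unfolding asymptotically_stable_def using stable \<delta>(1) by blast
qed

end
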